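(* Let $0<p<1$, $q=1-p$, and let $(T_n)_{n\ge0}$ be a random recursive tree process with uniform attachment insertion (probability $p$) and a deletion rule (probability $q$) such that the process supports conditional equiprobability. Let $S_n$ be the stratum number of $T_n$. Let $f$ be a real-valued function on the set of recursive trees and put $g(k)=\mathbb{E}_0[f(T_k)]$, the expectation of $f$ at time $k$ for the process with deletion probability $0$. Then for all $n\ge0$, $$\mathbb{E}_q[f(T_n)]=\mathbb{E}_q[g(S_n)],$$ where $\mathbb{E}_q$ denotes expectation for the process with deletion probability $q$.
   Context: A recursive tree with $m$ nodes is a rooted tree with nodes labeled $1,\dots,m$, rooted at node $1$, whose labels increase along every path away from the root. The stratum number of a tree is its number of nodes minus one; stratum $k$ is the set of the $k!$ recursive trees with stratum number $k$. The process $(T_n)_{n\ge0}$ is a Markov chain on recursive trees. $T_0$ is the single-node tree. At each step, with probability $p$ a new node labeled $k+2$ is attached to a uniformly chosen node of the current stratum $k$ tree (uniform attachment). With probability $q=1-p$ a deletion takes place: a stratum $k+1$ tree is replaced by a stratum $k$ tree according to a deletion rule, i.e. fixed transition probabilities from stratum $k+1$ trees to stratum $k$ trees, $k\ge0$; if the current tree is the single-node tree, it is left unchanged. With deletion probability $0$ (so insertion probability $1$), $T_k$ is the uniform recursive tree on $k+1$ nodes. The process supports conditional equiprobability if for every $n\ge1$, every $k$ with $\mathbb{P}\{S_n=k\}>0$ and every stratum $k$ tree $t$, $\mathbb{P}\{T_n=t\mid S_n=k\}=1/k!$. *)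

theory Defs
  imports "HOL-Probability.Probability"
begin

text \<open>Edges point away from the root.\<close>

definition rooted_tree :: "'a set \<Rightarrow> ('a \<times> 'a) set \<Rightarrow> 'a \<Rightarrow> bool" where
  "rooted_tree V E r \<longleftrightarrow>
     finite V \<and> r \<in> V \<and> E \<subseteq> V \<times> V \<and>
     (\<forall>u. (u, r) \<notin> E) \<and>
     (\<forall>v \<in> V - {r}. \<exists>!u. (u, v) \<in> E) \<and>
     (\<forall>v \<in> V. (r, v) \<in> E\<^sup>*)"

text \<open>A pair \<open>(m, E)\<close> stands for the tree with nodes \<open>1, \<dots>, m\<close> and edge set \<open>E\<close>.
  Since edges point away from the root, labels increase along all paths leaving the root
  iff they increase along every edge.\<close>

typedef recursive_tree =
  "{(m :: nat, E). rooted_tree {1..m} E 1 \<and> (\<forall>(u, v) \<in> E. u < v)}"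
proof
  show "(1, {}) \<in> {(m :: nat, E).
      rooted_tree {1..m} E 1 \<and> (\<forall>(u, v) \<in> E. u < v)}"
    by (auto simp: rooted_tree_def)
qed

definition node_count :: "recursive_tree \<Rightarrow> nat" where
  "node_count t = fst (Rep_recursive_tree t)"

definition nodes :: "recursive_tree \<Rightarrow> nat set" where
  "nodes t = {1..node_count t}"

definition edges :: "recursive_tree \<Rightarrow> (nat \<times> nat) set" where
  "edges t = snd (Rep_recursive_tree t)"

definition stratum :: "recursive_tree \<Rightarrow> nat" where
  "stratum t = node_count t - 1"

definition single_node_tree :: recursive_tree where
  "single_node_tree = Abs_recursive_tree (1, {})"

text \<open>Meaningful only for \<open>v \<in> nodes t\<close>; see \<open>Rep_attach\<close> below.\<close>

definition attach :: "recursive_tree \<Rightarrow> nat \<Rightarrow> recursive_tree" where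
  "attach t v = Abs_recursive_tree
     (node_count t + 1, insert (v, node_count t + 1) (edges t))"

lemma Rep_single_node_tree: "Rep_recursive_tree single_node_tree = (1, {})"
  unfolding single_node_tree_def
  by (rule Abs_recursive_tree_inverse) (auto simp: rooted_tree_def)

lemma Rep_attach:
  assumes "v \<in> nodes t"
  shows "Rep_recursive_tree (attach t v) =
    (node_count t + 1, insert (v, node_count t + 1) (edges t))"
proof -
  obtain m E where t: "Rep_recursive_tree t = (m, E)" by force
  have tree: "rooted_tree {1..m} E 1" and incr: "\<forall>(u, w) \<in> E. u < w"
    using Rep_recursive_tree[of t] t by auto
  have v: "1 \<le> v" "v \<le> m"
    using assms t by (auto simp: nodes_def node_count_def)
  have sub: "E \<subseteq> {1..m} \<times> {1..m}"
    using tree by (simp add: rooted_tree_def)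
  let ?E = "insert (v, Suc m) E"
  have reach: "(1, w) \<in> ?E\<^sup>*" if "w \<in> {1..m}" for w
  proof -
    have "(1, w) \<in> E\<^sup>*" using tree that by (auto simp: rooted_tree_def)
    then show ?thesis by (rule rtrancl_mono[THEN subsetD, rotated]) auto
  qed
  have last: "(1, Suc m) \<in> ?E\<^sup>*"
    using reach[of v] v by (auto intro: rtrancl_into_rtrancl)
  have parent: "\<exists>!u. (u, w) \<in> ?E" if "w \<in> {1..Suc m} - {1}" for w
  proof (cases "w = Suc m")
    case True
    then show ?thesis using sub by (intro ex1I[of _ v]) auto
  next
    case False
    then have "w \<in> {1..m} - {1}" using that by auto
    then have "\<exists>!u. (u, w) \<in> E" using tree unfolding rooted_tree_def by blast
    then show ?thesis using False by simp
  qed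
  have "rooted_tree {1..Suc m} ?E 1"
    unfolding rooted_tree_def
  proof (intro conjI)
    show "\<forall>u. (u, 1) \<notin> ?E" using tree v by (auto simp: rooted_tree_def)
    show "\<forall>w \<in> {1..Suc m}. (1, w) \<in> ?E\<^sup>*"
      using reach last by (metis atLeastAtMost_iff le_Suc_eq)
    show "?E \<subseteq> {1..Suc m} \<times> {1..Suc m}" using sub v by auto
  qed (use parent in auto)
  moreover have "\<forall>(u, w) \<in> ?E. u < w" using incr v by auto
  ultimately show ?thesis
    using t by (simp add: attach_def node_count_def edges_def Abs_recursive_tree_inverse)
qed

definition deletion_rule :: "(recursive_tree \<Rightarrow> recursive_tree pmf) \<Rightarrow> bool" where
  "deletion_rule D \<longleftrightarrow>
     (\<forall>k t. stratum t = k + 1 \<longrightarrow> (\<forall>t' \<in> set_pmf (D t). stratum t' = k))"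

definition transition ::
    "real \<Rightarrow> (recursive_tree \<Rightarrow> recursive_tree pmf) \<Rightarrow> recursive_tree \<Rightarrow> recursive_tree pmf" where
  "transition q D t =
     bind_pmf (bernoulli_pmf q) (\<lambda>deletion.
       if deletion then (if t = single_node_tree then return_pmf t else D t)
       else map_pmf (attach t) (pmf_of_set (nodes t)))"

definition markov_chain ::
    "'w measure \<Rightarrow> (nat \<Rightarrow> 'w \<Rightarrow> 's) \<Rightarrow> 's \<Rightarrow> ('s \<Rightarrow> 's pmf) \<Rightarrow> bool" where
  "markov_chain M X x0 K \<longleftrightarrow>
     prob_space M \<and>
     (\<forall>n. X n \<in> measurable M (count_space UNIV)) \<and>
     (AE \<omega> in M. X 0 \<omega> = x0) \<and>
     (\<forall>n h y. \<P>(\<omega> in M. \<forall>i\<le>n. X i \<omega> = h i) > 0 \<longrightarrow>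
        \<P>(\<omega> in M. X (n + 1) \<omega> = y \<bar> \<forall>i\<le>n. X i \<omega> = h i) = pmf (K (h n)) y)"

definition recursive_tree_process ::
    "real \<Rightarrow> (recursive_tree \<Rightarrow> recursive_tree pmf) \<Rightarrow>
     'w measure \<Rightarrow> (nat \<Rightarrow> 'w \<Rightarrow> recursive_tree) \<Rightarrow> bool" where
  "recursive_tree_process q D M T \<longleftrightarrow> markov_chain M T single_node_tree (transition q D)"

definition conditional_equiprobability ::
    "'w measure \<Rightarrow> (nat \<Rightarrow> 'w \<Rightarrow> recursive_tree) \<Rightarrow> bool" where
  "conditional_equiprobability M T \<longleftrightarrow>
     (\<forall>n\<ge>1. \<forall>k t. \<P>(\<omega> in M. stratum (T n \<omega>) = k) > 0 \<longrightarrow> stratum t = k \<longrightarrow>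
        \<P>(\<omega> in M. T n \<omega> = t \<bar> stratum (T n \<omega>) = k) = 1 / fact k)"

end

theory Submission imports Defs begin

text \<open>Deleting the largest label inverts attachment, so attachment is a bijection from pairs of a
  stratum \<open>k\<close> tree and one of its nodes to stratum \<open>k + 1\<close> trees; hence the pure insertion process
  is uniform on stratum \<open>k\<close> at time \<open>k\<close>. Conditional equiprobability says that \<open>T n\<close> arises by first
  drawing \<open>S n\<close> and then a uniform tree of that stratum. Conditioning on \<open>S n\<close> gives the identity
  for arbitrary \<open>f\<close>, since \<open>T n\<close> takes only finitely many values.\<close>

section \<open>Recursive trees by stratum\<close>

definition trees_of_stratum :: "nat \<Rightarrow> recursive_tree set" where
  "trees_of_stratum k = {t. stratum t = k}"

lemma node_count_pos: "0 < node_count t"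
  using Rep_recursive_tree[of t] by (auto simp: node_count_def rooted_tree_def)

text \<open>The subtraction in \<open>stratum\<close> is on naturals; since every tree contains its
  root, it never truncates.\<close>

lemma node_count_eq_Suc_stratum: "node_count t = Suc (stratum t)"
  using node_count_pos[of t] by (simp add: stratum_def)

lemma nodes_eq: "nodes t = {1..Suc (stratum t)}"
  by (simp add: nodes_def node_count_eq_Suc_stratum)

lemma stratum_attach: "v \<in> nodes t \<Longrightarrow> stratum (attach t v) = Suc (stratum t)"
  using node_count_pos[of t] by (simp add: stratum_def node_count_def Rep_attach)

lemma edges_subset: "edges t \<subseteq> {1..node_count t} \<times> {1..node_count t}"
  using Rep_recursive_tree[of t] by (auto simp: edges_def node_count_def rooted_tree_def)

text \<open>On one node the only possible edge is the loop at \<open>1\<close>, which increasing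
  labels forbid.\<close>

lemma stratum_eq_0_iff: "stratum t = 0 \<longleftrightarrow> t = single_node_tree"
proof
  assume t0: "stratum t = 0"
  obtain E where t: "Rep_recursive_tree t = (1, E)"
    using t0 node_count_eq_Suc_stratum[of t]
    by (metis One_nat_def node_count_def prod.collapse)
  have "E \<subseteq> {1} \<times> {1}" "\<forall>(u, v) \<in> E. u < v"
    using Rep_recursive_tree[of t] t by (auto simp: rooted_tree_def)
  then have "E = {}" by fastforce
  then show "t = single_node_tree"
    using t Rep_single_node_tree by (simp flip: Rep_recursive_tree_inject)
qed (simp add: stratum_def node_count_def Rep_single_node_tree)

lemma trees_of_stratum_0: "trees_of_stratum 0 = {single_node_tree}"
  by (simp add: trees_of_stratum_def stratum_eq_0_iff)

text \<open>Labels increase along edges, so the largest label is a leaf. Cutting it off with its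
  parent edge leaves the tree \<open>t\<close>, and its parent is the node \<open>v\<close>.\<close>

lemma attach_surj:
  assumes "stratum t' = Suc k"
  obtains t v where "stratum t = k" "v \<in> nodes t" "t' = attach t v"
proof -
  define m where "m = Suc k"
  have m: "1 \<le> m" by (simp add: m_def)
  obtain E where t': "Rep_recursive_tree t' = (Suc m, E)"
    using assms node_count_eq_Suc_stratum[of t']
    by (metis m_def node_count_def prod.collapse)
  have tree: "rooted_tree {1..Suc m} E 1" and incr: "\<And>u w. (u, w) \<in> E \<Longrightarrow> u < w"
    using Rep_recursive_tree[of t'] t' by auto
  have sub: "E \<subseteq> {1..Suc m} \<times> {1..Suc m}"
    and parent: "\<And>w. w \<in> {1..Suc m} - {1} \<Longrightarrow> \<exists>!u. (u, w) \<in> E"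
    and reach: "\<And>w. w \<in> {1..Suc m} \<Longrightarrow> (1, w) \<in> E\<^sup>*"
    using tree unfolding rooted_tree_def by blast+
  obtain v where v: "(v, Suc m) \<in> E" and v_unique: "\<And>u. (u, Suc m) \<in> E \<Longrightarrow> u = v"
    using parent[of "Suc m"] m by auto
  have v_range: "v \<in> {1..m}" using sub incr[OF v] v by auto
  define E' where "E' = {e \<in> E. snd e \<le> m}"
  have E_eq: "E = insert (v, Suc m) E'"
  proof
    show "E \<subseteq> insert (v, Suc m) E'"
    proof
      fix e assume e: "e \<in> E"
      obtain a b where ab: "e = (a, b)" by (cases e)
      show "e \<in> insert (v, Suc m) E'"
      proof (cases "b = Suc m")
        case True
        then show ?thesis using v_unique e ab by auto
      next
        case False
        then show ?thesis using sub e ab by (auto simp: E'_def)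
      qed
    qed
    show "insert (v, Suc m) E' \<subseteq> E" using v by (auto simp: E'_def)
  qed
  have sub': "E' \<subseteq> {1..m} \<times> {1..m}" using sub incr by (fastforce simp: E'_def)
  \<comment> \<open>A path into a label at most \<open>m\<close> only meets labels at most
    \<open>m\<close>, so it avoids the deleted edge. The bound sits inside the induction claim
    because it passes from \<open>z\<close> to its predecessor \<open>y < z\<close>.\<close>
  have reach': "w \<le> m \<longrightarrow> (1, w) \<in> E'\<^sup>*" if "(1, w) \<in> E\<^sup>*" for w
    using that
  proof (induction rule: rtrancl_induct)
    case (step y z)
    then show ?case using incr[of y z] by (auto simp: E'_def intro: rtrancl_into_rtrancl)
  qed simp
  have "rooted_tree {1..m} E' 1"
    unfolding rooted_tree_def
  proof (intro conjI ballI)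
    show "\<forall>u. (u, 1) \<notin> E'" using tree by (auto simp: rooted_tree_def E'_def)
    show "\<exists>!u. (u, w) \<in> E'" if "w \<in> {1..m} - {1}" for w
      using parent[of w] that by (auto simp: E'_def)
    show "(1, w) \<in> E'\<^sup>*" if "w \<in> {1..m}" for w
      using reach[of w] reach'[of w] that by auto
  qed (use sub' m in auto)
  then have "(m, E') \<in> {(m :: nat, E). rooted_tree {1..m} E 1 \<and> (\<forall>(u, v) \<in> E. u < v)}"
    using incr by (auto simp: E'_def)
  then have Rep: "Rep_recursive_tree (Abs_recursive_tree (m, E')) = (m, E')"
    by (rule Abs_recursive_tree_inverse)
  let ?t = "Abs_recursive_tree (m, E')"
  have "stratum ?t = k" and v_node: "v \<in> nodes ?t"
    using v_range by (simp_all add: stratum_def nodes_def node_count_def Rep) (simp add: m_def)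
  moreover have "t' = attach ?t v"
    using t' E_eq Rep_attach[OF v_node]
    by (simp add: node_count_def edges_def Rep flip: Rep_recursive_tree_inject)
  ultimately show thesis by (rule that)
qed

text \<open>The new label is met by no old edge, so the edge into it reveals the chosen node, and
  removing that edge recovers the old tree.\<close>

lemma attach_inject:
  assumes "v \<in> nodes t" "v' \<in> nodes t'" "attach t v = attach t' v'"
  shows "t = t' \<and> v = v'"
proof -
  have m: "node_count t = node_count t'"
    and ins: "insert (v, node_count t + 1) (edges t) = insert (v', node_count t + 1) (edges t')"
    using Rep_attach[OF assms(1)] Rep_attach[OF assms(2)] assms(3) by auto
  have fresh: "(u, node_count t + 1) \<notin> edges t" "(u, node_count t + 1) \<notin> edges t'" for u
    using edges_subset[of t] edges_subset[of t'] m by auto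
  then have "v = v'" using ins by blast
  with ins fresh have "edges t = edges t'" by (metis insert_ident)
  with m have "t = t'"
    by (simp add: node_count_def edges_def prod_eq_iff flip: Rep_recursive_tree_inject)
  with \<open>v = v'\<close> show ?thesis by simp
qed

text \<open>All trees of stratum \<open>k\<close> share the node set \<open>{1..Suc k}\<close>, so
  the pairs of a tree and a node form a plain product. This carries both the count and the
  uniformity below.\<close>

lemma bij_betw_attach:
  "bij_betw (\<lambda>(t, v). attach t v) (trees_of_stratum k \<times> {1..Suc k}) (trees_of_stratum (Suc k))"
  unfolding bij_betw_def
proof
  show "inj_on (\<lambda>(t, v). attach t v) (trees_of_stratum k \<times> {1..Suc k})"
    by (rule inj_onI) (auto simp: trees_of_stratum_def nodes_eq dest!: attach_inject[rotated 2])
  show "(\<lambda>(t, v). attach t v) ` (trees_of_stratum k \<times> {1..Suc k}) = trees_of_stratum (Suc k)"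
  proof
    show "(\<lambda>(t, v). attach t v) ` (trees_of_stratum k \<times> {1..Suc k}) \<subseteq> trees_of_stratum (Suc k)"
      by (auto simp: trees_of_stratum_def stratum_attach nodes_eq)
    show "trees_of_stratum (Suc k) \<subseteq> (\<lambda>(t, v). attach t v) ` (trees_of_stratum k \<times> {1..Suc k})"
    proof
      fix t' assume "t' \<in> trees_of_stratum (Suc k)"
      then have "stratum t' = Suc k" by (simp add: trees_of_stratum_def)
      then obtain t v where "stratum t = k" "v \<in> nodes t" "t' = attach t v"
        by (rule attach_surj)
      then show "t' \<in> (\<lambda>(t, v). attach t v) ` (trees_of_stratum k \<times> {1..Suc k})"
        by (intro image_eqI[of _ _ "(t, v)"]) (auto simp: trees_of_stratum_def nodes_eq)
    qed
  qed
qed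

lemma trees_of_stratum_finite_card:
  "finite (trees_of_stratum k) \<and> card (trees_of_stratum k) = fact k"
proof (induction k)
  case 0
  then show ?case by (simp add: trees_of_stratum_0)
next
  case (Suc k)
  then show ?case
    using bij_betw_finite[OF bij_betw_attach[of k]] bij_betw_same_card[OF bij_betw_attach[of k]]
    by (simp add: card_cartesian_product mult.commute)
qed

lemma finite_trees_of_stratum: "finite (trees_of_stratum k)"
  and card_trees_of_stratum: "card (trees_of_stratum k) = fact k"
  using trees_of_stratum_finite_card by blast+

text \<open>Together with finiteness this makes \<open>pmf_of_set\<close> on a stratum a genuine
  uniform law.\<close>

lemma trees_of_stratum_nonempty: "trees_of_stratum k \<noteq> {}"
  using card_trees_of_stratum[of k] by force

text \<open>Within a stratum the node is drawn independently of the tree, so the pair is uniform on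
  a product, and the attachment bijection transports a uniform law to a uniform law.\<close>

lemma uniform_attachment:
  "bind_pmf (pmf_of_set (trees_of_stratum k)) (\<lambda>t. map_pmf (attach t) (pmf_of_set (nodes t))) =
   pmf_of_set (trees_of_stratum (Suc k))"
proof -
  have "bind_pmf (pmf_of_set (trees_of_stratum k)) (\<lambda>t. map_pmf (attach t) (pmf_of_set (nodes t))) =
    bind_pmf (pmf_of_set (trees_of_stratum k)) (\<lambda>t. map_pmf (attach t) (pmf_of_set {1..Suc k}))"
    using trees_of_stratum_nonempty finite_trees_of_stratum
    by (intro bind_pmf_cong refl)
       (auto simp: trees_of_stratum_def nodes_eq)
  also have "\<dots> = map_pmf (\<lambda>(t, v). attach t v)
      (pair_pmf (pmf_of_set (trees_of_stratum k)) (pmf_of_set {1..Suc k}))"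
    by (simp add: pair_pmf_def map_bind_pmf bind_return_pmf map_pmf_def bind_assoc_pmf)
  also have "\<dots> = map_pmf (\<lambda>(t, v). attach t v)
      (pmf_of_set (trees_of_stratum k \<times> {1..Suc k}))"
    using trees_of_stratum_nonempty finite_trees_of_stratum
    by (intro arg_cong[where f = "map_pmf _"] pmf_eqI)
       (auto simp: pmf_pair card_cartesian_product indicator_def field_simps)
  also have "\<dots> = pmf_of_set (trees_of_stratum (Suc k))"
    using bij_betw_attach[of k] trees_of_stratum_nonempty finite_trees_of_stratum
    by (intro map_pmf_of_set_bij_betw) auto
  finally show ?thesis .
qed

text \<open>A tree is determined by its size and a finite edge set. Countability is what allows the
  law of \<open>T n\<close> to be handled as a pmf.\<close>

instance recursive_tree :: countable
proof
  let ?edges = "{E :: (nat \<times> nat) set. finite E}"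
  have fin: "snd (Rep_recursive_tree t) \<in> ?edges" for t
    using edges_subset[of t] by (auto simp: edges_def intro: finite_subset)
  have "countable ((UNIV :: nat set) \<times> ?edges)"
    by (intro countable_SIGMA countable_Collect_finite) auto
  moreover have "range Rep_recursive_tree \<subseteq> UNIV \<times> ?edges"
    using fin by (simp add: image_subset_iff mem_Times_iff)
  ultimately have "countable (range Rep_recursive_tree)"
    by (rule countable_subset[rotated])
  then have "countable (UNIV :: recursive_tree set)"
    by (rule countable_image_inj_on) (simp add: inj_on_def Rep_recursive_tree_inject)
  then show "\<exists>to_nat :: recursive_tree \<Rightarrow> nat. inj to_nat"
    by (auto elim: countableE)
qed

section \<open>Laws of countably valued random variables\<close>

text \<open>\<open>Abs_pmf\<close> is meaningful only on discrete distributions;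
  \<open>measure_pmf_law\<close> supplies this for measurable \<open>X\<close> with countable range
  type.\<close>

definition law :: "'w measure \<Rightarrow> ('w \<Rightarrow> 's) \<Rightarrow> 's pmf" where
  "law M X = Abs_pmf (distr M (count_space UNIV) X)"

context prob_space
begin

text \<open>On a countable type the points of mass zero form a null set, so the distribution lives
  on its atoms.\<close>

lemma measure_pmf_law:
  fixes X :: "'a \<Rightarrow> 's :: countable"
  assumes X: "X \<in> measurable M (count_space UNIV)"
  shows "measure_pmf (law M X) = distr M (count_space UNIV) X"
proof -
  interpret D: prob_space "distr M (count_space UNIV) X"
    by (rule prob_space_distr) (rule X)
  have "AE x in distr M (count_space UNIV) X. measure (distr M (count_space UNIV) X) {x} \<noteq> 0"
    by (subst D.AE_support_countable) (auto intro!: exI[of _ UNIV])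
  then show ?thesis
    unfolding law_def by (intro Abs_pmf_inverse) (simp add: D.prob_space_axioms)
qed

lemma pmf_law:
  fixes X :: "'a \<Rightarrow> 's :: countable"
  assumes "X \<in> measurable M (count_space UNIV)"
  shows "pmf (law M X) x = \<P>(\<omega> in M. X \<omega> = x)"
  using assms
  by (auto simp: pmf.rep_eq measure_pmf_law measure_distr intro!: arg_cong[where f = prob])

text \<open>Change of variables. If \<open>f (X \<omega>)\<close> is not integrable, both Bochner
  integrals take the default value 0.\<close>

lemma expectation_law:
  fixes X :: "'a \<Rightarrow> 's :: countable" and f :: "'s \<Rightarrow> real"
  assumes "X \<in> measurable M (count_space UNIV)"
  shows "measure_pmf.expectation (law M X) f = expectation (\<lambda>\<omega>. f (X \<omega>))"
  using assms by (simp add: measure_pmf_law integral_distr)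

lemma map_pmf_law:
  fixes X :: "'a \<Rightarrow> 's :: countable" and g :: "'s \<Rightarrow> 't :: countable"
  assumes X: "X \<in> measurable M (count_space UNIV)"
  shows "map_pmf g (law M X) = law M (\<lambda>\<omega>. g (X \<omega>))"
proof -
  have "(\<lambda>\<omega>. g (X \<omega>)) \<in> measurable M (count_space UNIV)"
    using X by measurable
  then show ?thesis
    using X by (simp add: measure_pmf_law map_pmf_rep_eq distr_distr comp_def
        flip: measure_pmf_inject)
qed

end

section \<open>One-step recursion for the laws of a Markov chain\<close>

lemma pmf_bind_map_Pair:
  "pmf (bind_pmf N (\<lambda>x. map_pmf (Pair x) (K x))) (x, y) = pmf N x * pmf (K x) y"
proof -
  have "pmf (map_pmf (Pair x') (K x')) (x, y) = indicator {x} x' * pmf (K x) y" for x'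
  proof (cases "x' = x")
    case True
    then show ?thesis by (simp add: pmf_map_inj' inj_on_def)
  next
    case False
    then show ?thesis by (auto simp: pmf_eq_0_set_pmf)
  qed
  then show ?thesis by (simp add: pmf_bind measure_pmf_single)
qed

lemma markov_chain_law_0:
  fixes X :: "nat \<Rightarrow> 'w \<Rightarrow> 's :: countable"
  assumes "markov_chain M X x0 K"
  shows "law M (X 0) = return_pmf x0"
proof -
  interpret prob_space M using assms by (simp add: markov_chain_def)
  have X: "X n \<in> measurable M (count_space UNIV)" for n
    using assms by (simp add: markov_chain_def)
  have "AE \<omega> in M. X 0 \<omega> = x0" using assms by (simp add: markov_chain_def)
  then have "AE x in law M (X 0). x = x0"
    unfolding measure_pmf_law[OF X] by (subst AE_distr_iff[OF X]) auto
  then have "set_pmf (law M (X 0)) \<subseteq> {x0}" by (auto simp: AE_measure_pmf_iff)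
  then show ?thesis by (simp add: set_pmf_subset_singleton)
qed

text \<open>The Markov property conditions on whole histories, so the one-step recursion for the laws
  comes from the joint law of the history, kept as a list to stay countable, and the next state.\<close>

lemma markov_chain_law_Suc:
  fixes X :: "nat \<Rightarrow> 'w \<Rightarrow> 's :: countable"
  assumes mc: "markov_chain M X x0 K"
  shows "law M (X (Suc n)) = bind_pmf (law M (X n)) K"
proof -
  interpret prob_space M using mc by (simp add: markov_chain_def)
  have X[measurable]: "X n \<in> measurable M (count_space UNIV)" for n
    using mc by (simp add: markov_chain_def)
  define H where "H \<omega> = map (\<lambda>i. X i \<omega>) [0..<Suc n]" for \<omega>
  have H_eq: "H \<omega> = l \<longleftrightarrow> length l = Suc n \<and> (\<forall>i\<le>n. X i \<omega> = l ! i)" for \<omega> l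
    by (auto simp: H_def list_eq_iff_nth_eq less_Suc_eq_le simp del: upt_Suc)
  have last_H: "last (H \<omega>) = X n \<omega>" for \<omega> by (simp add: H_def)
  \<comment> \<open>The lists form a countable type, so singletons suffice, and each of their
    preimages is cut out by finitely many conditions on the \<open>X i\<close>.\<close>
  have H[measurable]: "H \<in> measurable M (count_space UNIV)"
  proof (subst measurable_count_space_eq2_countable, intro conjI ballI)
    fix l
    have "{\<omega> \<in> space M. H \<omega> = l} \<in> events" unfolding H_eq by measurable
    then show "H -` {l} \<inter> space M \<in> events" by (simp add: vimage_def Int_def conj_commute)
  qed auto
  have HX: "(\<lambda>\<omega>. (H \<omega>, X (Suc n) \<omega>)) \<in> measurable M (count_space UNIV)"
    by measurable
  \<comment> \<open>For a history of positive probability this is the Markov property multiplied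
    out; for a null history both sides vanish.\<close>
  have joint: "\<P>(\<omega> in M. H \<omega> = l \<and> X (Suc n) \<omega> = y) = \<P>(\<omega> in M. H \<omega> = l) * pmf (K (last l)) y"
    for l y
  proof (cases "\<P>(\<omega> in M. H \<omega> = l) > 0")
    case True
    then have len: "length l = Suc n"
      by (metis (mono_tags, lifting) H_eq Collect_empty_eq less_irrefl measure_empty)
    have ev: "H \<omega> = l \<longleftrightarrow> (\<forall>i\<le>n. X i \<omega> = l ! i)" for \<omega> using len by (simp add: H_eq)
    have "\<P>(\<omega> in M. X (Suc n) \<omega> = y \<bar> H \<omega> = l) = pmf (K (l ! n)) y"
      using mc True unfolding markov_chain_def ev by simp
    moreover have "last l = l ! n" using len by (subst last_conv_nth) auto
    ultimately show ?thesis using True by (simp add: cond_prob_def field_simps conj_commute)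
  next
    case False
    then have "\<P>(\<omega> in M. H \<omega> = l) = 0" by (simp add: zero_less_measure_iff)
    moreover have "\<P>(\<omega> in M. H \<omega> = l \<and> X (Suc n) \<omega> = y) \<le> \<P>(\<omega> in M. H \<omega> = l)"
      by (intro finite_measure_mono) auto
    ultimately show ?thesis by (simp add: measure_le_0_iff)
  qed
  have "law M (\<lambda>\<omega>. (H \<omega>, X (Suc n) \<omega>)) =
    bind_pmf (law M H) (\<lambda>l. map_pmf (Pair l) (K (last l)))"
    by (intro pmf_eqI, clarify)
       (simp add: pmf_bind_map_Pair pmf_law[OF HX] pmf_law[OF H] joint)
  \<comment> \<open>The kernel sees only the last entry of the history, so after projecting to the
    next state only the law of \<open>X n\<close> remains.\<close>
  then have "map_pmf snd (law M (\<lambda>\<omega>. (H \<omega>, X (Suc n) \<omega>))) = bind_pmf (law M H) (\<lambda>l. K (last l))"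
    by (simp add: map_bind_pmf map_pmf_comp)
  then have "law M (X (Suc n)) = bind_pmf (map_pmf last (law M H)) K"
    by (simp add: map_pmf_law[OF HX] bind_map_pmf)
  then show ?thesis by (simp add: map_pmf_law[OF H] last_H)
qed

section \<open>Recursive tree processes\<close>

lemma transition_0:
  "transition 0 D t = map_pmf (attach t) (pmf_of_set (nodes t))"
proof -
  have "bernoulli_pmf 0 = return_pmf False"
    by (subst set_pmf_subset_singleton[symmetric]) (auto simp: set_pmf_iff)
  then show ?thesis by (simp add: transition_def bind_return_pmf)
qed

text \<open>Identifies the law behind \<open>g k\<close>: with deletion probability 0 each step is a
  uniform attachment, which takes the uniform law from stratum to stratum.\<close>

lemma law_insertion_process:
  assumes "recursive_tree_process 0 D M T"
  shows "law M (T k) = pmf_of_set (trees_of_stratum k)"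
proof (induction k)
  case 0
  then show ?case
    using assms
    by (simp add: recursive_tree_process_def markov_chain_law_0 trees_of_stratum_0
        pmf_of_set_singleton)
next
  case (Suc k)
  have "law M (T (Suc k)) = bind_pmf (law M (T k)) (transition 0 D)"
    using assms by (simp add: recursive_tree_process_def markov_chain_law_Suc)
  then show ?case by (simp add: Suc transition_0[abs_def] uniform_attachment)
qed

lemma stratum_transition:
  assumes "deletion_rule D" "t' \<in> set_pmf (transition q D t)"
  shows "stratum t' \<le> Suc (stratum t)"
proof -
  consider "t' = t" | "t \<noteq> single_node_tree" "t' \<in> set_pmf (D t)"
    | v where "v \<in> nodes t" "t' = attach t v"
  proof -
    obtain deletion where "t' \<in> set_pmf (if deletion
        then (if t = single_node_tree then return_pmf t else D t)
        else map_pmf (attach t) (pmf_of_set (nodes t)))"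
      using assms(2) unfolding transition_def by auto
    moreover have "set_pmf (pmf_of_set (nodes t)) = nodes t"
      by (simp add: nodes_eq set_pmf_of_set)
    ultimately show thesis
      using that by (cases deletion; cases "t = single_node_tree") auto
  qed
  then show ?thesis
  proof cases
    case 2
    then have "stratum t \<noteq> 0" by (simp add: stratum_eq_0_iff)
    then obtain k where "stratum t = k + 1" by (metis Suc_eq_plus1 not0_implies_Suc)
    with 2 assms(1) have "stratum t' = k" unfolding deletion_rule_def by blast
    with \<open>stratum t = k + 1\<close> show ?thesis by simp
  qed (auto simp: stratum_attach)
qed

text \<open>Bounds the support of the stratum number at time \<open>n\<close>, which turns the
  expectations into finite sums for an arbitrary real \<open>f\<close>.\<close>

lemma stratum_le_time:
  assumes "deletion_rule D" "recursive_tree_process q D M T"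
    and "t \<in> set_pmf (law M (T n))"
  shows "stratum t \<le> n"
  using assms(3)
proof (induction n arbitrary: t)
  case 0
  then show ?case
    using assms(2)
    by (simp add: recursive_tree_process_def markov_chain_law_0 stratum_eq_0_iff)
next
  case (Suc n)
  have "law M (T (Suc n)) = bind_pmf (law M (T n)) (transition q D)"
    using assms(2) by (simp add: recursive_tree_process_def markov_chain_law_Suc)
  with Suc.prems obtain s where "s \<in> set_pmf (law M (T n))" "t \<in> set_pmf (transition q D s)"
    by auto
  then show ?case using Suc.IH[of s] stratum_transition[OF assms(1), of t q s] by simp
qed

text \<open>Conditional equiprobability in mixture form: draw the stratum number first, then a
  uniform tree of that stratum.\<close>

lemma law_conditional_equiprobability:
  assumes proc: "recursive_tree_process q D M T" and ce: "conditional_equiprobability M T"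
  shows "law M (T n) =
    bind_pmf (law M (\<lambda>\<omega>. stratum (T n \<omega>))) (\<lambda>k. pmf_of_set (trees_of_stratum k))"
proof (cases "n = 0")
  \<comment> \<open>The definition of equiprobability starts at time 1; at time 0 the chain sits in
    stratum 0, which has a single tree.\<close>
  case True
  have mc: "markov_chain M T single_node_tree (transition q D)"
    using proc by (simp add: recursive_tree_process_def)
  interpret prob_space M using mc by (simp add: markov_chain_def)
  have T: "T 0 \<in> measurable M (count_space UNIV)" using mc by (simp add: markov_chain_def)
  have "law M (\<lambda>\<omega>. stratum (T 0 \<omega>)) = return_pmf 0"
    using map_pmf_law[OF T, of stratum] by (simp add: markov_chain_law_0[OF mc] stratum_eq_0_iff[THEN iffD2])
  then show ?thesis
    using True by (simp add: markov_chain_law_0[OF mc] bind_return_pmf trees_of_stratum_0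
        pmf_of_set_singleton)
next
  case False
  interpret prob_space M
    using proc by (simp add: recursive_tree_process_def markov_chain_def)
  have T[measurable]: "T n \<in> measurable M (count_space UNIV)"
    using proc by (simp add: recursive_tree_process_def markov_chain_def)
  have S[measurable]: "(\<lambda>\<omega>. stratum (T n \<omega>)) \<in> measurable M (count_space UNIV)"
    by measurable
  show ?thesis
  proof (rule pmf_eqI)
    fix t
    let ?k = "stratum t"
    let ?P = "\<P>(\<omega> in M. stratum (T n \<omega>) = ?k)"
    \<comment> \<open>Uniform laws on other strata give \<open>t\<close> no mass, so only the
      stratum of \<open>t\<close> contributes to the mixture.\<close>
    have "pmf (pmf_of_set (trees_of_stratum k)) t = indicator {?k} k / fact ?k" for k
      using finite_trees_of_stratum trees_of_stratum_nonempty card_trees_of_stratum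
      by (auto simp: trees_of_stratum_def indicator_def)
    then have rhs: "pmf (bind_pmf (law M (\<lambda>\<omega>. stratum (T n \<omega>)))
        (\<lambda>k. pmf_of_set (trees_of_stratum k))) t = ?P / fact ?k"
      by (simp add: pmf_bind measure_pmf_single pmf_law[OF S])
    have "\<P>(\<omega> in M. T n \<omega> = t) = ?P / fact ?k"
    proof (cases "?P > 0")
      case True
      have "{\<omega> \<in> space M. T n \<omega> = t \<and> stratum (T n \<omega>) = ?k} = {\<omega> \<in> space M. T n \<omega> = t}"
        by auto
      moreover have "\<P>(\<omega> in M. T n \<omega> = t \<bar> stratum (T n \<omega>) = ?k) = 1 / fact ?k"
        using ce True False by (simp add: conditional_equiprobability_def)
      ultimately show ?thesis using True by (simp add: cond_prob_def field_simps)
    next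
      \<comment> \<open>On a null stratum equiprobability asserts nothing, but the event that
        \<open>T n\<close> equals \<open>t\<close> is contained in it and is null as well.\<close>
      case False
      then have "?P = 0" by (simp add: zero_less_measure_iff)
      moreover have "\<P>(\<omega> in M. T n \<omega> = t) \<le> ?P"
        by (intro finite_measure_mono) auto
      ultimately show ?thesis by (simp add: measure_le_0_iff)
    qed
    with rhs show "pmf (law M (T n)) t = pmf (bind_pmf (law M (\<lambda>\<omega>. stratum (T n \<omega>)))
        (\<lambda>k. pmf_of_set (trees_of_stratum k))) t"
      by (simp add: pmf_law[OF T])
  qed
qed

theorem mainTheorem12:
  fixes p q :: real
    and D :: "recursive_tree \<Rightarrow> recursive_tree pmf"
    and M :: "'a measure" and T :: "nat \<Rightarrow> 'a \<Rightarrow> recursive_tree"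
    and M0 :: "'b measure" and T0 :: "nat \<Rightarrow> 'b \<Rightarrow> recursive_tree"
    and f :: "recursive_tree \<Rightarrow> real" and g :: "nat \<Rightarrow> real"
    and S :: "nat \<Rightarrow> 'a \<Rightarrow> nat"
  assumes "0 < p" and "p < 1" and "q = 1 - p"
    and "deletion_rule D"
    and "recursive_tree_process q D M T"
    and "conditional_equiprobability M T"
    and "\<And>n \<omega>. S n \<omega> = stratum (T n \<omega>)"
    and "recursive_tree_process 0 D M0 T0"
    and "\<And>k. g k = prob_space.expectation M0 (\<lambda>\<omega>. f (T0 k \<omega>))"
  shows "\<forall>n. prob_space.expectation M (\<lambda>\<omega>. f (T n \<omega>)) =
             prob_space.expectation M (\<lambda>\<omega>. g (S n \<omega>))"
proof
  fix n
  interpret M: prob_space M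
    using assms(5) by (simp add: recursive_tree_process_def markov_chain_def)
  interpret M0: prob_space M0
    using assms(8) by (simp add: recursive_tree_process_def markov_chain_def)
  have T[measurable]: "T n \<in> measurable M (count_space UNIV)"
    using assms(5) by (simp add: recursive_tree_process_def markov_chain_def)
  have T0: "T0 k \<in> measurable M0 (count_space UNIV)" for k
    using assms(8) by (simp add: recursive_tree_process_def markov_chain_def)
  have S: "S n \<in> measurable M (count_space UNIV)"
    unfolding assms(7) by measurable
  have S_eq: "law M (S n) = map_pmf stratum (law M (T n))"
    by (simp add: M.map_pmf_law[OF T] flip: assms(7))
  have supp: "set_pmf (law M (S n)) \<subseteq> {..n}"
    using stratum_le_time[OF assms(4,5)] by (auto simp: S_eq)
  \<comment> \<open>The two processes live on different probability spaces and meet only here,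
    through the uniform law on stratum \<open>k\<close>.\<close>
  have g: "measure_pmf.expectation (pmf_of_set (trees_of_stratum k)) f = g k" for k
    by (simp add: assms(9) M0.expectation_law[OF T0] flip: law_insertion_process[OF assms(8)])
  have "M.expectation (\<lambda>\<omega>. f (T n \<omega>)) = measure_pmf.expectation (law M (T n)) f"
    by (simp add: M.expectation_law[OF T])
  also have "\<dots> = measure_pmf.expectation
      (bind_pmf (law M (S n)) (\<lambda>k. pmf_of_set (trees_of_stratum k))) f"
    by (simp add: law_conditional_equiprobability[OF assms(5,6), of n] flip: assms(7))
  \<comment> \<open>Conditioning on the stratum number: each of the finitely many possible strata
    contributes its uniform mean of \<open>f\<close>.\<close>
  also have "\<dots> = (\<Sum>k\<le>n. pmf (law M (S n)) k * g k)"
    using supp finite_trees_of_stratum trees_of_stratum_nonempty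
    by (subst pmf_expectation_bind[where A = "{..n}"]) (auto simp: g)
  also have "\<dots> = measure_pmf.expectation (law M (S n)) g"
    using supp by (subst integral_measure_pmf_real[where A = "{..n}"]) (auto simp: mult.commute)
  also have "\<dots> = M.expectation (\<lambda>\<omega>. g (S n \<omega>))"
    by (simp add: M.expectation_law[OF S])
  finally show "M.expectation (\<lambda>\<omega>. f (T n \<omega>)) = M.expectation (\<lambda>\<omega>. g (S n \<omega>))" .
qed

end
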